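(* Let $\theta>0$ and $\xi\in[0,1]$, and let $p_n^{\theta,\xi}$ ($n\ge 1$) be the persistence probabilities defined in the context. Then the following hold. (a) $p_n^{\theta,\xi}=p_n^{1/\theta,1-\xi}$ for all $n\geq 1$. (b) For $\theta=1$, $p_n^{1,\xi}=\frac{1}{(n+1)!}$ for all $n\ge 1$. (c) For $\xi=1$, $p_n^{\theta,1}=\frac{\theta^{n(n+1)/2}}{[n+1]_\theta!}$ for all $n\ge 1$. For $\xi=0$, $p_n^{\theta,0}=\frac{1}{[n+1]_\theta!}$ for all $n\ge1$. (d) If $\theta\neq 1$ and $\xi\in[0,1)$, then $$p_n^{\theta,\xi}=\frac{\left(-\frac{\xi}{1-\xi};\theta\right)_{n+1}}{(\theta;\theta)_{n+1}}\,(1-\theta)^{n+1}(1-\xi)^{n+1},\qquad n\geq 1.$$ (e) For any $\theta>0$, the generating function of $(p_n^{\theta,\xi})_{n\ge1}$ equals, for $z\in\mathbb{C}$ with $|z|<1$, $$\sum_{n=1}^\infty p_n^{\theta,\xi}z^n=\frac1z\left(\frac{e_\theta\bigl((1-\xi)z\bigr)}{e_\theta\bigl(-\xi z\bigr)}-1\right)-1$$ (with the right-hand side understood by continuity at $z=0$).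
   Context: Let $(X_i)_{i\ge 0}$ be i.i.d. real random variables with density $\xi e^{x}\mathbf 1_{x<0}+(1-\xi)e^{-x}\mathbf 1_{x>0}$, $x\in\mathbb{R}$, where $\xi\in[0,1]$. For $\theta\in\mathbb{R}$ and $n\ge1$ put $$p_n^{\theta,\xi}:=\mathbb{P}(X_1>\theta X_0,\ X_2>\theta X_1,\ \ldots,\ X_n>\theta X_{n-1}).$$ Notation: the $q$-Pochhammer symbol is $(a;q)_n:=\prod_{k=0}^{n-1}(1-aq^k)$; the $q$-factorial is $[n]_q!:=\prod_{k=1}^n\frac{1-q^k}{1-q}$, with continuous extension $[n]_1!=n!$; and $e_q(z):=\sum_{n=0}^\infty \frac{z^n}{[n]_q!}$, which converges at least for $|z|<1$ when $q>0$. *)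

theory Defs
  imports "HOL-Probability.Probability"
begin

definition two_sided_exp_density :: "real \<Rightarrow> real \<Rightarrow> real" where
  "two_sided_exp_density \<xi> x = \<xi> * exp x * indicator {..<0} x + (1 - \<xi>) * exp (- x) * indicator {0<..} x"

definition iid_two_sided_exp :: "real \<Rightarrow> 'a measure \<Rightarrow> (nat \<Rightarrow> 'a \<Rightarrow> real) \<Rightarrow> bool" where
  "iid_two_sided_exp \<xi> M X \<longleftrightarrow>
     prob_space M \<and>
     prob_space.indep_vars M (\<lambda>_. borel) X UNIV \<and>
     (\<forall>i. distributed M lborel (X i) (\<lambda>x. ennreal (two_sided_exp_density \<xi> x)))"

definition persistence_prob :: "'a measure \<Rightarrow> (nat \<Rightarrow> 'a \<Rightarrow> real) \<Rightarrow> real \<Rightarrow> nat \<Rightarrow> real" where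
  "persistence_prob M X \<theta> n = measure M {\<omega> \<in> space M. \<forall>k\<in>{1..n}. X k \<omega> > \<theta> * X (k - 1) \<omega>}"

definition q_pochhammer :: "real \<Rightarrow> real \<Rightarrow> nat \<Rightarrow> real" where
  "q_pochhammer a q n = (\<Prod>k<n. 1 - a * q ^ k)"

definition q_fact :: "real \<Rightarrow> nat \<Rightarrow> real" where
  "q_fact q n = (if q = 1 then fact n else (\<Prod>k=1..n. (1 - q ^ k) / (1 - q)))"

definition q_exp :: "real \<Rightarrow> complex \<Rightarrow> complex" where
  "q_exp q z = (\<Sum>n. z ^ n / of_real (q_fact q n))"

text \<open>The right-hand side of the generating function identity. At \<open>z = 0\<close> the formula has a
  removable singularity, so this function is only meaningful for \<open>z \<noteq> 0\<close>.\<close>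

definition persistence_gf :: "real \<Rightarrow> real \<Rightarrow> complex \<Rightarrow> complex" where
  "persistence_gf \<theta> \<xi> z =
     1 / z * (q_exp \<theta> (of_real (1 - \<xi>) * z) / q_exp \<theta> (- of_real \<xi> * z) - 1) - 1"

text \<open>The series defining \<^const>\<open>q_exp\<close> converges in the open unit disc.\<close>

lemma q_fact_ge_1:
  assumes "q > 0"
  shows "q_fact q n \<ge> 1"
proof (cases "q = 1")
  case False
  have "1 \<le> (1 - q ^ k) / (1 - q)" if "k \<in> {1..n}" for k
  proof -
    have "(1 - q ^ k) / (1 - q) = (\<Sum>i<k. q ^ i)"
      using False sum_gp_strict[of q k] by simp
    moreover have "(\<Sum>i\<in>{0}. q ^ i) \<le> (\<Sum>i<k. q ^ i)"
      using that assms by (intro sum_mono2) auto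
    ultimately show ?thesis by simp
  qed
  then have "1 \<le> (\<Prod>k=1..n. (1 - q ^ k) / (1 - q))"
    by (rule prod_ge_1)
  with False show ?thesis by (simp add: q_fact_def)
qed (simp add: q_fact_def)

lemma summable_q_exp:
  assumes "q > 0" "norm z < 1"
  shows "summable (\<lambda>n. z ^ n / complex_of_real (q_fact q n))"
proof (rule summable_comparison_test')
  show "summable (\<lambda>n. norm z ^ n)" using assms by (intro summable_geometric) simp
  fix n :: nat
  show "norm (z ^ n / complex_of_real (q_fact q n)) \<le> norm z ^ n"
    using q_fact_ge_1[OF assms(1), of n]
    by (simp add: norm_divide norm_power divide_le_eq mult_left_le mult_le_cancel_left1)
qed

text \<open>Processes satisfying \<^const>\<open>iid_two_sided_exp\<close> exist.\<close>

lemma prob_space_two_sided_exp: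
  assumes "0 \<le> \<xi>" "\<xi> \<le> 1"
  shows "prob_space (density lborel (\<lambda>x. ennreal (two_sided_exp_density \<xi> x)))"
proof
  let ?e = "\<lambda>x. ennreal (exponential_density 1 x)"
  have int: "(\<integral>\<^sup>+x. ?e x \<partial>lborel) = 1"
    using prob_space.emeasure_space_1[OF prob_space_exponential_density[of 1]]
    by (simp add: emeasure_density)
  have int': "(\<integral>\<^sup>+x. ?e (- x) \<partial>lborel) = 1"
    using int by (subst (asm) nn_integral_real_affine[where c = "-1" and t = 0]) auto
  have "emeasure (density lborel (\<lambda>x. ennreal (two_sided_exp_density \<xi> x))) UNIV
      = (\<integral>\<^sup>+x. ennreal (two_sided_exp_density \<xi> x) \<partial>lborel)"
    by (subst emeasure_density) (auto simp: two_sided_exp_density_def)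
  also have "\<dots> = (\<integral>\<^sup>+x. ennreal \<xi> * ?e (- x) + ennreal (1 - \<xi>) * ?e x \<partial>lborel)"
  proof (rule nn_integral_cong_AE)
    show "AE x in lborel. ennreal (two_sided_exp_density \<xi> x)
            = ennreal \<xi> * ?e (- x) + ennreal (1 - \<xi>) * ?e x"
      using AE_lborel_singleton[of "0 :: real"]
    proof eventually_elim
      case (elim x)
      then show ?case using assms
        by (auto simp: two_sided_exp_density_def exponential_density_def indicator_def
              simp flip: ennreal_mult' ennreal_plus)
    qed
  qed
  also have "\<dots> = ennreal \<xi> + ennreal (1 - \<xi>)"
    by (simp add: nn_integral_add nn_integral_cmult int int')
  also have "\<dots> = 1" using assms by (simp flip: ennreal_plus)
  finally show "emeasure (density lborel (\<lambda>x. ennreal (two_sided_exp_density \<xi> x)))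
      (space (density lborel (\<lambda>x. ennreal (two_sided_exp_density \<xi> x)))) = 1"
    by simp
qed

lemma iid_two_sided_exp_exists:
  assumes "0 \<le> \<xi>" "\<xi> \<le> 1"
  shows "\<exists>(M :: (nat \<Rightarrow> real) measure) X. iid_two_sided_exp \<xi> M X"
proof -
  define D where "D = density lborel (\<lambda>x. ennreal (two_sided_exp_density \<xi> x))"
  define P where "P = PiM (UNIV :: nat set) (\<lambda>_. D)"
  interpret D: prob_space D
    unfolding D_def by (rule prob_space_two_sided_exp[OF assms])
  interpret P: prob_space P
    unfolding P_def by (intro prob_space_PiM D.prob_space_axioms)
  have setsD [measurable_cong]: "sets D = sets borel" by (simp add: D_def)
  have comp: "distr P borel (\<lambda>\<omega>. \<omega> i) = D" for i
  proof -
    have "distr P borel (\<lambda>\<omega>. \<omega> i) = distr P D (\<lambda>\<omega>. \<omega> i)"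
      by (rule distr_cong) (simp_all add: setsD)
    also have "\<dots> = D"
      unfolding P_def by (rule distr_PiM_component) (simp_all add: D.prob_space_axioms)
    finally show ?thesis .
  qed
  have sp: "sets P = sets (PiM UNIV (\<lambda>_. borel))"
    unfolding P_def by (intro sets_PiM_cong) (simp_all add: setsD)
  have rv: "(\<lambda>\<omega>. \<omega> i) \<in> measurable P borel" for i
    unfolding P_def by measurable
  have "P.indep_vars (\<lambda>_. borel) (\<lambda>i \<omega>. \<omega> i) UNIV"
  proof (subst P.indep_vars_iff_distr_eq_PiM)
    show "distr P (PiM UNIV (\<lambda>_. borel)) (\<lambda>\<omega>. \<lambda>i\<in>UNIV. \<omega> i)
        = PiM UNIV (\<lambda>i. distr P borel (\<lambda>\<omega>. \<omega> i))"
      unfolding comp using distr_id2[OF sp[symmetric]] by (simp add: P_def restrict_def)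
  qed (use rv in auto)
  moreover have "distributed P lborel (\<lambda>\<omega>. \<omega> i) (\<lambda>x. ennreal (two_sided_exp_density \<xi> x))" for i
  proof -
    have "distr P lborel (\<lambda>\<omega>. \<omega> i) = distr P borel (\<lambda>\<omega>. \<omega> i)"
      by (rule distr_cong) simp_all
    then show ?thesis
      using rv[of i] comp[of i] unfolding distributed_def D_def
      by (auto simp: two_sided_exp_density_def)
  qed
  ultimately have "iid_two_sided_exp \<xi> P (\<lambda>i \<omega>. \<omega> i)"
    unfolding iid_two_sided_exp_def using P.prob_space_axioms by blast
  then show ?thesis by blast
qed

end

theory Submission
  imports Defs
begin

text \<open>Integrating out the variables from the last one backwards leads to the functions
  \<open>T\<^sub>0 = 1\<close>, \<open>T\<^sub>n\<^sub>+\<^sub>1(u) = \<integral>\<^sub>u\<^sup>\<infinity> f(y) T\<^sub>n(\<theta> y) dy\<close>, where \<open>f\<close> is the density, and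
  \<open>p\<^sub>n = T\<^sub>n\<^sub>+\<^sub>1(-\<infinity>)\<close>. On the positive half line \<open>T\<^sub>n(u) = (1 - \<xi>)\<^sup>n e\<^sup>-\<^sup>[\<^sup>n\<^sup>]\<^sup>u / [n]!\<close> with
  \<open>[n] = 1 + \<theta> + \<dots> + \<theta>\<^sup>n\<^sup>-\<^sup>1\<close>, and on the negative half line
  \<open>T\<^sub>n(u) = \<Sum>\<^sub>j (-\<xi>)\<^sup>j / [j]! b\<^sub>n\<^sub>-\<^sub>j e\<^sup>[\<^sup>j\<^sup>]\<^sup>u\<close> with \<open>b\<^sub>m = T\<^sub>m(-\<infinity>)\<close>. Continuity at \<open>0\<close> reads
  \<open>\<Sum>\<^sub>j (-\<xi>)\<^sup>j / [j]! b\<^sub>n\<^sub>-\<^sub>j = (1 - \<xi>)\<^sup>n / [n]!\<close>. This is the generating function identity, and it is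
  solved by \<open>b\<^sub>m = \<Prod>\<^sub>k\<^sub><\<^sub>m (1 - \<xi> + \<xi> \<theta>\<^sup>k) / [m]!\<close>.\<close>

section \<open>The coefficients and their algebraic identities\<close>

lemma q_fact_0 [simp]: "q_fact q 0 = 1"
  by (simp add: q_fact_def)

text \<open>Writing the new factor as a finite geometric sum covers both branches of
  \<open>q_fact\<close>, so that \<theta> = 1 needs no separate treatment in the arguments built on
  this recursion.\<close>

lemma q_fact_Suc: "q_fact q (Suc n) = q_fact q n * (\<Sum>i\<le>n. q ^ i)"
  by (auto simp: q_fact_def sum_gp_strict lessThan_Suc_atMost[symmetric] simp del: sum.lessThan_Suc)

text \<open>The index is shifted: the persistence probability \<open>p\<^sub>n\<close> is \<open>persist_coeff \<theta> \<xi> (n + 1)\<close>.\<close>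

definition persist_coeff :: "real \<Rightarrow> real \<Rightarrow> nat \<Rightarrow> real" where
  "persist_coeff \<theta> \<xi> m = (\<Prod>k<m. 1 - \<xi> + \<xi> * \<theta> ^ k) / q_fact \<theta> m"

lemma persist_coeff_0 [simp]: "persist_coeff \<theta> \<xi> 0 = 1"
  by (simp add: persist_coeff_def)

lemma persist_coeff_Suc:
  "persist_coeff \<theta> \<xi> (Suc m) = persist_coeff \<theta> \<xi> m * (1 - \<xi> + \<xi> * \<theta> ^ m) / (\<Sum>i\<le>m. \<theta> ^ i)"
  by (simp add: persist_coeff_def q_fact_Suc)

lemma q_num_pos:
  fixes q :: real
  assumes "q > 0"
  shows "(\<Sum>i\<le>n. q ^ i) > 0"
  using assms by (intro sum_pos) auto

lemma persist_coeff_nonneg: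
  assumes "\<theta> > 0" "0 \<le> \<xi>" "\<xi> \<le> 1"
  shows "0 \<le> persist_coeff \<theta> \<xi> m"
  unfolding persist_coeff_def using q_fact_ge_1[OF assms(1), of m] assms
  by (intro divide_nonneg_nonneg prod_nonneg) auto

text \<open>Each quotient of consecutive coefficients is at most 1: for m = 0 it equals 1, and for m
  > 0 the geometric sum in the denominator contains both 1 and \<open>\<theta> ^ m\<close>. The
  bound gives convergence of the generating function in the open unit disc.\<close>

lemma persist_coeff_le_1:
  assumes "\<theta> > 0" "0 \<le> \<xi>" "\<xi> \<le> 1"
  shows "persist_coeff \<theta> \<xi> m \<le> 1"
proof (induction m)
  case (Suc m)
  have "1 - \<xi> + \<xi> * \<theta> ^ m \<le> (\<Sum>i\<le>m. \<theta> ^ i)"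
  proof (cases m)
    case (Suc k)
    have "(\<Sum>i\<in>{0, Suc k}. \<theta> ^ i) \<le> (\<Sum>i\<le>Suc k. \<theta> ^ i)"
      using assms by (intro sum_mono2) auto
    then have "1 + \<theta> ^ m \<le> (\<Sum>i\<le>m. \<theta> ^ i)"
      using Suc by simp
    moreover have "\<xi> * \<theta> ^ m \<le> \<theta> ^ m"
      using assms by (simp add: mult_left_le_one_le)
    ultimately show ?thesis using assms by linarith
  qed simp
  then have "persist_coeff \<theta> \<xi> m * (1 - \<xi> + \<xi> * \<theta> ^ m) \<le> 1 * (\<Sum>i\<le>m. \<theta> ^ i)"
    using Suc.IH assms by (intro mult_mono) auto
  then show ?case
    using q_num_pos[OF assms(1), of m] by (simp add: persist_coeff_Suc)
qed simp

text \<open>The recursion factor is unchanged when its numerator and denominator are divided by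
  \<open>\<theta> ^ m\<close>. This reverses the geometric sum and exchanges the roles of \<xi> and
  1 - \<xi>.\<close>

lemma persist_coeff_inverse:
  assumes "\<theta> > 0"
  shows "persist_coeff (1 / \<theta>) (1 - \<xi>) m = persist_coeff \<theta> \<xi> m"
proof (induction m)
  case (Suc m)
  have "(\<Sum>i\<le>m. (1 / \<theta>) ^ i) = (\<Sum>i\<le>m. \<theta> ^ i) / \<theta> ^ m"
  proof -
    have "(\<Sum>i\<le>m. \<theta> ^ i) = (\<Sum>i\<le>m. \<theta> ^ (m - i))"
      by (rule sum.reindex_bij_witness[of _ "\<lambda>i. m - i" "\<lambda>i. m - i"]) auto
    then have "(\<Sum>i\<le>m. \<theta> ^ i) / \<theta> ^ m = (\<Sum>i\<le>m. \<theta> ^ (m - i) / \<theta> ^ m)"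
      by (simp add: sum_divide_distrib)
    also have "\<dots> = (\<Sum>i\<le>m. (1 / \<theta>) ^ i)"
      using assms by (intro sum.cong) (auto simp: power_diff power_divide)
    finally show ?thesis ..
  qed
  moreover have "1 - (1 - \<xi>) + (1 - \<xi>) * (1 / \<theta>) ^ m = (1 - \<xi> + \<xi> * \<theta> ^ m) / \<theta> ^ m"
    using assms by (simp add: field_simps)
  ultimately show ?case
    unfolding persist_coeff_Suc Suc.IH using assms by simp
qed simp

text \<open>Writing \<open>[k]\<close> for the \<open>q\<close>-number \<open>1 + \<theta> + \<dots> + \<theta>\<^sup>k\<^sup>-\<^sup>1\<close>, the splitting
  \<open>[n] = [n - j] + \<theta>\<^sup>n\<^sup>-\<^sup>j [j]\<close> shows that \<open>[n]\<close> times the left-hand side is \<open>1 - \<xi>\<close> times the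
  left-hand side for \<open>n - 1\<close>: the terms carrying a power of \<open>\<theta>\<close> cancel.\<close>

lemma persist_coeff_convolution:
  assumes "\<theta> > 0"
  shows "(\<Sum>j\<le>n. (- \<xi>) ^ j / q_fact \<theta> j * persist_coeff \<theta> \<xi> (n - j)) = (1 - \<xi>) ^ n / q_fact \<theta> n"
proof (induction n)
  case (Suc n)
  define d where "d j = (- \<xi>) ^ j / q_fact \<theta> j" for j
  define b where "b = persist_coeff \<theta> \<xi>"
  define N where "N k = (\<Sum>i<k. \<theta> ^ i)" for k
  have N: "N (Suc k) > 0" for k
    using q_num_pos[OF assms, of k] by (simp add: N_def lessThan_Suc_atMost)
  have bS: "N (Suc m) * b (Suc m) = (1 - \<xi> + \<xi> * \<theta> ^ m) * b m" for m
    using N[of m] unfolding b_def persist_coeff_Suc by (simp add: N_def lessThan_Suc_atMost)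
  have dS: "N (Suc m) * d (Suc m) = - \<xi> * d m" for m
    using N[of m] unfolding d_def q_fact_Suc by (simp add: N_def lessThan_Suc_atMost)
  have split: "N (Suc n) = N (Suc n - j) + \<theta> ^ (Suc n - j) * N j" if "j \<le> Suc n" for j
  proof -
    have "N (a + c) = N a + \<theta> ^ a * N c" for a c
      by (induction c) (simp_all add: N_def power_add algebra_simps)
    from this[of "Suc n - j" j] that show ?thesis by simp
  qed
  have "N (Suc n) * (\<Sum>j\<le>Suc n. d j * b (Suc n - j))
      = (\<Sum>j\<le>Suc n. d j * (N (Suc n - j) * b (Suc n - j)))
        + (\<Sum>j\<le>Suc n. \<theta> ^ (Suc n - j) * (N j * d j) * b (Suc n - j))"
    unfolding sum_distrib_left sum.distrib[symmetric]
  proof (rule sum.cong)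
    fix j assume "j \<in> {..Suc n}"
    then show "N (Suc n) * (d j * b (Suc n - j)) = d j * (N (Suc n - j) * b (Suc n - j)) +
        \<theta> ^ (Suc n - j) * (N j * d j) * b (Suc n - j)"
      by (subst split[of j]) (auto simp: algebra_simps)
  qed simp
  \<comment> \<open>Since \<open>N 0 = 0\<close>, this sum loses its last term and the other one
    loses its first. After an index shift in the latter, both run over j \<le> n.\<close>
  also have "(\<Sum>j\<le>Suc n. d j * (N (Suc n - j) * b (Suc n - j)))
      = (\<Sum>j\<le>n. d j * ((1 - \<xi> + \<xi> * \<theta> ^ (n - j)) * b (n - j)))"
  proof -
    have "(\<Sum>j\<le>Suc n. d j * (N (Suc n - j) * b (Suc n - j)))
       = (\<Sum>j\<le>n. d j * (N (Suc n - j) * b (Suc n - j)))"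
      by (simp add: N_def)
    also have "\<dots> = (\<Sum>j\<le>n. d j * ((1 - \<xi> + \<xi> * \<theta> ^ (n - j)) * b (n - j)))"
      by (intro sum.cong) (auto simp: Suc_diff_le bS)
    finally show ?thesis .
  qed
  also have "(\<Sum>j\<le>Suc n. \<theta> ^ (Suc n - j) * (N j * d j) * b (Suc n - j))
      = (\<Sum>j\<le>n. \<theta> ^ (n - j) * (- \<xi> * d j) * b (n - j))"
    by (subst sum.atMost_Suc_shift) (simp add: dS, simp add: N_def)
  also have "(\<Sum>j\<le>n. d j * ((1 - \<xi> + \<xi> * \<theta> ^ (n - j)) * b (n - j)))
      + (\<Sum>j\<le>n. \<theta> ^ (n - j) * (- \<xi> * d j) * b (n - j)) = (1 - \<xi>) * (\<Sum>j\<le>n. d j * b (n - j))"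
    unfolding sum_distrib_left sum.distrib[symmetric] by (intro sum.cong) (auto simp: algebra_simps)
  also have "\<dots> = (1 - \<xi>) ^ Suc n / q_fact \<theta> n"
    using Suc.IH by (simp add: d_def b_def)
  finally have "(\<Sum>j\<le>Suc n. d j * b (Suc n - j)) = (1 - \<xi>) ^ Suc n / q_fact \<theta> n / N (Suc n)"
    using N[of n] by (metis nonzero_mult_div_cancel_left less_irrefl)
  then show ?case
    by (simp add: d_def b_def N_def q_fact_Suc lessThan_Suc_atMost)
qed simp

section \<open>The generating function\<close>

lemma persist_coeff_sums:
  fixes z :: complex
  assumes "\<theta> > 0" "0 \<le> \<xi>" "\<xi> \<le> 1" "norm z < 1"
  shows "summable (\<lambda>n. of_real (persist_coeff \<theta> \<xi> n) * z ^ n)"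
    and "q_exp \<theta> (- of_real \<xi> * z) * (\<Sum>n. of_real (persist_coeff \<theta> \<xi> n) * z ^ n)
           = q_exp \<theta> (of_real (1 - \<xi>) * z)"
proof -
  let ?b = "persist_coeff \<theta> \<xi>"
  let ?d = "\<lambda>n. (- of_real \<xi> * z) ^ n / complex_of_real (q_fact \<theta> n)"
  have geo: "summable (\<lambda>n. norm z ^ n)" using assms by (intro summable_geometric) simp
  have b: "summable (\<lambda>n. norm (of_real (?b n) * z ^ n))"
    using persist_coeff_nonneg[OF assms(1-3)] persist_coeff_le_1[OF assms(1-3)]
    by (intro summable_comparison_test'[OF geo])
       (auto simp: norm_mult norm_power mult_left_le_one_le)
  then show "summable (\<lambda>n. of_real (?b n) * z ^ n)"
    by (rule summable_norm_cancel)
  have d: "summable (\<lambda>n. norm (?d n))"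
  proof (intro summable_comparison_test'[OF geo])
    fix n :: nat
    have "norm (?d n) = (\<xi> * norm z) ^ n / q_fact \<theta> n"
      using assms q_fact_ge_1[OF assms(1), of n] by (simp add: norm_divide norm_power norm_mult)
    also have "\<dots> \<le> (\<xi> * norm z) ^ n / 1"
      using q_fact_ge_1[OF assms(1), of n] assms by (intro divide_left_mono) auto
    also have "\<dots> \<le> norm z ^ n"
      using assms by (simp, intro power_mono) (auto simp: mult_left_le_one_le)
    finally show "norm (norm (?d n)) \<le> norm z ^ n" by simp
  qed
  \<comment> \<open>Both series are dominated by the geometric series in \<open>norm z\<close>, so
    they may be multiplied termwise; the coefficients of the product are given by
    \<open>persist_coeff_convolution\<close>.\<close>
  have "(\<lambda>k. \<Sum>i\<le>k. ?d i * (of_real (?b (k - i)) * z ^ (k - i))) sums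
      ((\<Sum>k. ?d k) * (\<Sum>k. of_real (?b k) * z ^ k))"
    by (rule Cauchy_product_sums[OF d b])
  moreover have "(\<Sum>i\<le>k. ?d i * (of_real (?b (k - i)) * z ^ (k - i)))
      = (of_real (1 - \<xi>) * z) ^ k / of_real (q_fact \<theta> k)" for k
  proof -
    have "(\<Sum>i\<le>k. ?d i * (of_real (?b (k - i)) * z ^ (k - i)))
        = (\<Sum>i\<le>k. of_real ((- \<xi>) ^ i / q_fact \<theta> i * ?b (k - i)) * z ^ k)"
    proof (rule sum.cong)
      fix i assume "i \<in> {..k}"
      then have "z ^ k = z ^ i * z ^ (k - i)" by (simp flip: power_add)
      moreover have "(- of_real \<xi> * z) ^ i = of_real ((- \<xi>) ^ i) * z ^ i"
        by (simp only: power_mult_distrib of_real_power of_real_minus)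
      ultimately show "?d i * (of_real (?b (k - i)) * z ^ (k - i))
          = of_real ((- \<xi>) ^ i / q_fact \<theta> i * ?b (k - i)) * z ^ k"
        by (simp only: of_real_mult of_real_divide) simp
    qed simp
    also have "\<dots> = of_real ((1 - \<xi>) ^ k / q_fact \<theta> k) * z ^ k"
      unfolding sum_distrib_right[symmetric] of_real_sum[symmetric]
        persist_coeff_convolution[OF assms(1)] ..
    finally show ?thesis by (simp add: power_mult_distrib)
  qed
  ultimately show "q_exp \<theta> (- of_real \<xi> * z) * (\<Sum>n. of_real (?b n) * z ^ n)
      = q_exp \<theta> (of_real (1 - \<xi>) * z)"
    unfolding q_exp_def by (simp add: sums_iff)
qed

text \<open>At \<open>\<xi> = 1\<close> the product formula exhibits an inverse of \<open>q_exp\<close>.\<close>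

lemma q_exp_nonzero:
  assumes "q > 0" "norm z < 1"
  shows "q_exp q z \<noteq> 0"
proof -
  have "q_exp q 0 = 1"
    unfolding q_exp_def using powser_zero[of "\<lambda>n. 1 / complex_of_real (q_fact q n)"]
    by simp
  then show ?thesis
    using persist_coeff_sums(2)[of q 1 "- z"] assms by auto
qed

lemma persist_coeff_gf_sums:
  fixes z :: complex
  assumes "\<theta> > 0" "0 \<le> \<xi>" "\<xi> \<le> 1" "norm z < 1" "z \<noteq> 0"
  shows "(\<lambda>n. of_real (persist_coeff \<theta> \<xi> (n + 2)) * z ^ Suc n) sums persistence_gf \<theta> \<xi> z"
proof -
  let ?B = "\<Sum>n. of_real (persist_coeff \<theta> \<xi> n) * z ^ n"
  have "norm (- of_real \<xi> * z) < 1"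
    using le_less_trans[OF mult_left_le_one_le[of "norm z" \<xi>] assms(4)] assms
    by (simp add: norm_mult)
  then have "q_exp \<theta> (- of_real \<xi> * z) \<noteq> 0"
    by (rule q_exp_nonzero[OF assms(1)])
  then have B: "?B = q_exp \<theta> (of_real (1 - \<xi>) * z) / q_exp \<theta> (- of_real \<xi> * z)"
    using persist_coeff_sums(2)[OF assms(1-4)] by (simp add: field_simps)
  have "(\<lambda>n. of_real (persist_coeff \<theta> \<xi> n) * z ^ n) sums ?B"
    using persist_coeff_sums(1)[OF assms(1-4)] by (rule summable_sums)
  \<comment> \<open>The coefficients with index 0 and 1 are both 1. Removing them and dividing by z
    produces the two subtractions in \<open>persistence_gf\<close>.\<close>
  then have "(\<lambda>n. of_real (persist_coeff \<theta> \<xi> (n + 2)) * z ^ (n + 2)) sums (?B - (1 + z))"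
    using sums_iff_shift[of "\<lambda>n. of_real (persist_coeff \<theta> \<xi> n) * z ^ n" 2 "?B - (1 + z)"]
    by (simp add: eval_nat_numeral persist_coeff_Suc)
  then have "(\<lambda>n. 1 / z * (of_real (persist_coeff \<theta> \<xi> (n + 2)) * z ^ (n + 2))) sums (1 / z * (?B - (1 + z)))"
    by (rule sums_mult)
  moreover have "1 / z * (?B - (1 + z)) = persistence_gf \<theta> \<xi> z"
    using assms(5) unfolding persistence_gf_def B[symmetric] by (simp add: field_simps)
  moreover have "1 / z * (of_real (persist_coeff \<theta> \<xi> (n + 2)) * z ^ (n + 2))
      = of_real (persist_coeff \<theta> \<xi> (n + 2)) * z ^ Suc n" for n
    using assms(5) by simp
  ultimately show ?thesis by simp
qed

section \<open>The tail functions, their derivatives and their signs\<close>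

text \<open>\<open>tail \<theta> \<xi> n u\<close> is, for \<open>n \<ge> 1\<close>, the probability that \<open>X\<^sub>1 > u\<close> and \<open>X\<^sub>k > \<theta> X\<^sub>k\<^sub>-\<^sub>1\<close> for \<open>2 \<le> k \<le> n\<close>.
  Only the restriction of \<open>tail_neg\<close> to the negative half line and that of \<open>tail_pos\<close> to the
  positive one have this meaning.\<close>

definition tail_neg :: "real \<Rightarrow> real \<Rightarrow> nat \<Rightarrow> real \<Rightarrow> real" where
  "tail_neg \<theta> \<xi> n x =
     (\<Sum>j\<le>n. (- \<xi>) ^ j / q_fact \<theta> j * persist_coeff \<theta> \<xi> (n - j) * exp ((\<Sum>i<j. \<theta> ^ i) * x))"

definition tail_pos :: "real \<Rightarrow> real \<Rightarrow> nat \<Rightarrow> real \<Rightarrow> real" where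
  "tail_pos \<theta> \<xi> n x = (1 - \<xi>) ^ n / q_fact \<theta> n * exp (- ((\<Sum>i<n. \<theta> ^ i) * x))"

definition tail :: "real \<Rightarrow> real \<Rightarrow> nat \<Rightarrow> real \<Rightarrow> real" where
  "tail \<theta> \<xi> n x = (if x \<ge> 0 then tail_pos \<theta> \<xi> n x else tail_neg \<theta> \<xi> n x)"

lemma tail_0 [simp]: "tail \<theta> \<xi> 0 x = 1"
  by (simp add: tail_def tail_pos_def tail_neg_def)

lemma tail_neg_at_0:
  assumes "\<theta> > 0"
  shows "tail_neg \<theta> \<xi> n 0 = tail_pos \<theta> \<xi> n 0"
  using persist_coeff_convolution[OF assms, of \<xi> n] by (simp add: tail_neg_def tail_pos_def)

lemma borel_measurable_tail [measurable]:
  "tail_neg \<theta> \<xi> n \<in> borel_measurable borel"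
  "tail_pos \<theta> \<xi> n \<in> borel_measurable borel"
  "tail \<theta> \<xi> n \<in> borel_measurable borel"
  unfolding tail_def[abs_def] tail_neg_def[abs_def] tail_pos_def[abs_def] by measurable

lemma q_num_Suc_shift:
  fixes q :: real
  shows "(\<Sum>i<Suc n. q ^ i) = 1 + q * (\<Sum>i<n. q ^ i)"
  by (subst sum.lessThan_Suc_shift) (simp add: sum_distrib_left)

text \<open>Differentiation kills the constant term j = 0. In the others the factor [j + 1] cancels
  against the q-factorial, and [j + 1] = 1 + \<theta> [j] splits the exponential into
  \<open>exp x\<close> and an exponential evaluated at \<open>\<theta> * x\<close>.\<close>

lemma DERIV_tail_neg:
  assumes "\<theta> > 0"
  shows "(tail_neg \<theta> \<xi> (Suc n) has_real_derivative - (\<xi> * exp x * tail_neg \<theta> \<xi> n (\<theta> * x))) (at x)"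
proof -
  let ?N = "\<lambda>j. \<Sum>i<j. \<theta> ^ i"
  let ?c = "\<lambda>n j. (- \<xi>) ^ j / q_fact \<theta> j * persist_coeff \<theta> \<xi> (n - j)"
  have "((\<lambda>x. \<Sum>j\<le>Suc n. ?c (Suc n) j * exp (?N j * x)) has_real_derivative
      (\<Sum>j\<le>Suc n. ?c (Suc n) j * (exp (?N j * x) * ?N j))) (at x)"
    by (intro DERIV_sum DERIV_cmult) (auto intro!: derivative_eq_intros)
  also have "(\<Sum>j\<le>Suc n. ?c (Suc n) j * (exp (?N j * x) * ?N j))
      = (\<Sum>j\<le>n. ?c (Suc n) (Suc j) * (exp (?N (Suc j) * x) * ?N (Suc j)))"
    by (subst sum.atMost_Suc_shift) simp
  also have "\<dots> = (\<Sum>j\<le>n. - (\<xi> * exp x * (?c n j * exp (?N j * (\<theta> * x)))))"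
  proof (rule sum.cong)
    fix j
    have "?N (Suc j) > 0" using q_num_pos[OF assms, of j] by (simp only: lessThan_Suc_atMost)
    then have "?c (Suc n) (Suc j) * ?N (Suc j) = - \<xi> * ?c n j"
      by (simp add: q_fact_Suc lessThan_Suc_atMost[symmetric] del: sum.lessThan_Suc)
    moreover have "exp (?N (Suc j) * x) = exp x * exp (?N j * (\<theta> * x))"
      unfolding q_num_Suc_shift by (simp add: exp_add[symmetric] algebra_simps)
    moreover have "?c (Suc n) (Suc j) * (exp (?N (Suc j) * x) * ?N (Suc j))
        = (?c (Suc n) (Suc j) * ?N (Suc j)) * exp (?N (Suc j) * x)"
      by (simp only: mult_ac)
    ultimately show "?c (Suc n) (Suc j) * (exp (?N (Suc j) * x) * ?N (Suc j))
        = - (\<xi> * exp x * (?c n j * exp (?N j * (\<theta> * x))))"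
      by (simp only: mult_ac mult_minus_left mult_minus_right)
  qed simp
  also have "\<dots> = - (\<xi> * exp x * tail_neg \<theta> \<xi> n (\<theta> * x))"
    by (simp only: tail_neg_def sum_distrib_left sum_negf)
  finally show ?thesis
    by (simp only: tail_neg_def[abs_def])
qed

lemma DERIV_tail_pos:
  assumes "\<theta> > 0"
  shows "(tail_pos \<theta> \<xi> (Suc n) has_real_derivative - ((1 - \<xi>) * exp (- x) * tail_pos \<theta> \<xi> n (\<theta> * x))) (at x)"
proof -
  let ?N = "\<lambda>j. \<Sum>i<j. \<theta> ^ i"
  have N: "?N (Suc n) > 0" using q_num_pos[OF assms, of n] by (simp only: lessThan_Suc_atMost)
  have "(tail_pos \<theta> \<xi> (Suc n) has_real_derivative
      (1 - \<xi>) ^ Suc n / q_fact \<theta> (Suc n) * (exp (- (?N (Suc n) * x)) * - ?N (Suc n))) (at x)"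
    unfolding tail_pos_def[abs_def] by (rule derivative_eq_intros refl | simp)+
  moreover have "exp (- (?N (Suc n) * x)) = exp (- x) * exp (- (?N n * (\<theta> * x)))"
    unfolding q_num_Suc_shift by (simp add: exp_add[symmetric] algebra_simps)
  moreover have "(1 - \<xi>) ^ Suc n / q_fact \<theta> (Suc n) * ?N (Suc n) = (1 - \<xi>) * ((1 - \<xi>) ^ n / q_fact \<theta> n)"
    using N by (simp add: q_fact_Suc lessThan_Suc_atMost[symmetric] del: sum.lessThan_Suc)
  moreover have "(1 - \<xi>) ^ Suc n / q_fact \<theta> (Suc n) * (exp (- (?N (Suc n) * x)) * - ?N (Suc n))
      = - ((1 - \<xi>) ^ Suc n / q_fact \<theta> (Suc n) * ?N (Suc n) * exp (- (?N (Suc n) * x)))"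
    by (simp only: mult_ac mult_minus_left mult_minus_right)
  ultimately show ?thesis
    unfolding tail_pos_def by (simp only: mult_ac)
qed

lemma tail_pos_nonneg:
  assumes "\<theta> > 0" "\<xi> \<le> 1"
  shows "0 \<le> tail_pos \<theta> \<xi> n x"
  unfolding tail_pos_def using q_fact_ge_1[OF assms(1), of n] assms
  by (intro mult_nonneg_nonneg divide_nonneg_nonneg) auto

text \<open>Nonnegativity at level n makes the derivative at level n + 1 nonpositive. It is kept as
  a hypothesis because \<open>tail_neg_nonneg\<close> applies this lemma inside its own
  induction.\<close>

lemma tail_neg_Suc_ge:
  assumes "\<theta> > 0" "0 \<le> \<xi>" "x \<le> 0"
    and nonneg: "\<And>y. y \<le> 0 \<Longrightarrow> 0 \<le> tail_neg \<theta> \<xi> n y"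
  shows "tail_neg \<theta> \<xi> (Suc n) 0 \<le> tail_neg \<theta> \<xi> (Suc n) x"
proof (rule DERIV_nonpos_imp_nonincreasing[OF assms(3)])
  fix y :: real assume "y \<le> 0"
  then have "0 \<le> tail_neg \<theta> \<xi> n (\<theta> * y)"
    using assms(1) by (intro nonneg) (simp add: mult_le_0_iff)
  then show "\<exists>D. (tail_neg \<theta> \<xi> (Suc n) has_real_derivative D) (at y) \<and> D \<le> 0"
    using DERIV_tail_neg[OF assms(1)] assms(2) by fastforce
qed

text \<open>The defining sum has alternating signs, so nonnegativity cannot be read off its terms.
  Instead, the function decreases towards its value at 0, which equals that of
  \<open>tail_pos\<close>.\<close>

lemma tail_neg_nonneg:
  assumes "\<theta> > 0" "0 \<le> \<xi>" "\<xi> \<le> 1" "x \<le> 0"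
  shows "0 \<le> tail_neg \<theta> \<xi> n x"
  using assms(4)
proof (induction n arbitrary: x)
  case (Suc n)
  have "tail_neg \<theta> \<xi> (Suc n) 0 \<le> tail_neg \<theta> \<xi> (Suc n) x"
    using assms Suc.prems Suc.IH by (intro tail_neg_Suc_ge)
  then show ?case
    using tail_pos_nonneg[OF assms(1,3), of "Suc n" 0] by (simp add: tail_neg_at_0[OF assms(1)])
qed (simp add: tail_neg_def)

lemma tail_neg_ge:
  assumes "\<theta> > 0" "0 \<le> \<xi>" "\<xi> \<le> 1" "x \<le> 0"
  shows "tail_neg \<theta> \<xi> (Suc n) 0 \<le> tail_neg \<theta> \<xi> (Suc n) x"
  using assms by (intro tail_neg_Suc_ge tail_neg_nonneg)

section \<open>Integrals of the tail functions against the density\<close>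

lemma tendsto_exp_neg_mult_at_top:
  fixes c :: real
  assumes "c > 0"
  shows "((\<lambda>x. exp (- (c * x))) \<longlongrightarrow> 0) at_top"
proof -
  have "filterlim (\<lambda>x. c * x) at_top at_top"
    using assms by (intro filterlim_tendsto_pos_mult_at_top[OF tendsto_const] filterlim_ident)
  then show ?thesis
    by (intro filterlim_compose[OF exp_at_bot]) (simp add: filterlim_uminus_at_bot)
qed

lemma nn_integral_tail_pos:
  assumes "\<theta> > 0" "\<xi> \<le> 1"
  shows "(\<integral>\<^sup>+y. ennreal ((1 - \<xi>) * exp (- y) * tail_pos \<theta> \<xi> n (\<theta> * y)) * indicator {u..} y \<partial>lborel)
      = ennreal (tail_pos \<theta> \<xi> (Suc n) u)"
proof -
  have "(\<Sum>i<Suc n. \<theta> ^ i) > 0" using q_num_pos[OF assms(1), of n] by (simp only: lessThan_Suc_atMost)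
  then have "((\<lambda>y. - tail_pos \<theta> \<xi> (Suc n) y) \<longlongrightarrow> - 0) at_top"
    unfolding tail_pos_def by (intro tendsto_minus tendsto_mult_right_zero tendsto_exp_neg_mult_at_top)
  then have "(\<integral>\<^sup>+y. ennreal ((1 - \<xi>) * exp (- y) * tail_pos \<theta> \<xi> n (\<theta> * y)) * indicator {u..} y \<partial>lborel)
      = ennreal (- 0 - - tail_pos \<theta> \<xi> (Suc n) u)"
    using DERIV_minus[OF DERIV_tail_pos[OF assms(1)]] assms tail_pos_nonneg[OF assms]
    by (intro nn_integral_FTC_atLeast) auto
  then show ?thesis by simp
qed

lemma nn_integral_tail_neg_Icc:
  assumes "\<theta> > 0" "0 \<le> \<xi>" "\<xi> \<le> 1" "u \<le> 0"
  shows "(\<integral>\<^sup>+y. ennreal (\<xi> * exp y * tail_neg \<theta> \<xi> n (\<theta> * y)) * indicator {u..0} y \<partial>lborel)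
      = ennreal (tail_neg \<theta> \<xi> (Suc n) u - tail_neg \<theta> \<xi> (Suc n) 0)"
proof -
  have "0 \<le> tail_neg \<theta> \<xi> n (\<theta> * y)" if "y \<le> 0" for y
    using assms that by (intro tail_neg_nonneg) (auto simp: mult_le_0_iff)
  then have "(\<integral>\<^sup>+y. ennreal (\<xi> * exp y * tail_neg \<theta> \<xi> n (\<theta> * y)) * indicator {u..0} y \<partial>lborel)
      = ennreal (- tail_neg \<theta> \<xi> (Suc n) 0 - - tail_neg \<theta> \<xi> (Suc n) u)"
    using DERIV_minus[OF DERIV_tail_neg[OF assms(1)]] assms
    by (intro nn_integral_FTC_Icc) auto
  then show ?thesis by simp
qed

text \<open>At minus infinity only the constant term of \<open>tail_neg\<close> survives, and this
  is \<open>persist_coeff \<theta> \<xi> (Suc n)\<close>. The second claim ensures that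
  \<open>ennreal\<close> does not truncate the difference in the first.\<close>

lemma nn_integral_tail_neg:
  assumes "\<theta> > 0" "0 \<le> \<xi>" "\<xi> \<le> 1"
  shows "(\<integral>\<^sup>+y. ennreal (\<xi> * exp y * tail_neg \<theta> \<xi> n (\<theta> * y)) * indicator {..0} y \<partial>lborel)
      = ennreal (persist_coeff \<theta> \<xi> (Suc n) - tail_neg \<theta> \<xi> (Suc n) 0)"
    and "tail_neg \<theta> \<xi> (Suc n) 0 \<le> persist_coeff \<theta> \<xi> (Suc n)"
proof -
  let ?N = "\<lambda>j. \<Sum>i<j. \<theta> ^ i"
  let ?c = "\<lambda>n j. (- \<xi>) ^ j / q_fact \<theta> j * persist_coeff \<theta> \<xi> (n - j)"
  have eq: "tail_neg \<theta> \<xi> (Suc n) (- y) = persist_coeff \<theta> \<xi> (Suc n)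
      + (\<Sum>j\<le>n. ?c (Suc n) (Suc j) * exp (- (?N (Suc j) * y)))" for y
    unfolding tail_neg_def by (subst sum.atMost_Suc_shift) simp
  have N: "?N (Suc j) > 0" for j
    using q_num_pos[OF assms(1), of j] by (simp only: lessThan_Suc_atMost)
  have "((\<lambda>y. persist_coeff \<theta> \<xi> (Suc n) + (\<Sum>j\<le>n. ?c (Suc n) (Suc j) * exp (- (?N (Suc j) * y))))
      \<longlongrightarrow> persist_coeff \<theta> \<xi> (Suc n) + (\<Sum>j\<le>n. 0)) at_top"
    by (intro tendsto_intros tendsto_mult_right_zero tendsto_exp_neg_mult_at_top N)
  then have lim: "((\<lambda>y. tail_neg \<theta> \<xi> (Suc n) (- y)) \<longlongrightarrow> persist_coeff \<theta> \<xi> (Suc n)) at_top"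
    by (simp only: eq sum.neutral_const add_0_right)
  show "tail_neg \<theta> \<xi> (Suc n) 0 \<le> persist_coeff \<theta> \<xi> (Suc n)"
    using tail_neg_ge[OF assms, of _ n]
    by (intro tendsto_lowerbound[OF lim] eventually_mono[OF eventually_ge_at_top[of 0]]) auto
  have nonneg: "0 \<le> tail_neg \<theta> \<xi> n (\<theta> * (- y))" if "y \<ge> 0" for y
    using assms that by (intro tail_neg_nonneg) (auto simp: mult_le_0_iff)
  have deriv: "((\<lambda>y. tail_neg \<theta> \<xi> (Suc n) (- y)) has_real_derivative
      \<xi> * exp (- y) * tail_neg \<theta> \<xi> n (\<theta> * (- y))) (at y)" for y
    using DERIV_chain2[OF DERIV_tail_neg[OF assms(1), of \<xi> n "- y"] DERIV_minus[OF DERIV_ident]]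
    by simp
  \<comment> \<open>The reflection of y to -y moves the integral to \<open>{0..}\<close>, where the
    fundamental theorem with a limit at infinity applies.\<close>
  have "(\<integral>\<^sup>+y. ennreal (\<xi> * exp y * tail_neg \<theta> \<xi> n (\<theta> * y)) * indicator {..0} y \<partial>lborel)
     = (\<integral>\<^sup>+y. ennreal (\<xi> * exp (- y) * tail_neg \<theta> \<xi> n (\<theta> * (- y))) * indicator {0..} y \<partial>lborel)"
    by (subst nn_integral_real_affine[where c = "-1" and t = 0])
       (auto intro!: nn_integral_cong simp: indicator_def)
  also have "\<dots> = ennreal (persist_coeff \<theta> \<xi> (Suc n) - tail_neg \<theta> \<xi> (Suc n) (- 0))"
    using deriv nonneg lim assms by (intro nn_integral_FTC_atLeast) auto
  finally show "(\<integral>\<^sup>+y. ennreal (\<xi> * exp y * tail_neg \<theta> \<xi> n (\<theta> * y)) * indicator {..0} y \<partial>lborel)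
      = ennreal (persist_coeff \<theta> \<xi> (Suc n) - tail_neg \<theta> \<xi> (Suc n) 0)" by simp
qed

text \<open>As \<theta> > 0, the points y and \<open>\<theta> * y\<close> have the same sign, so the
  density and \<open>tail\<close> switch branches together. The two half lines overlap in the null
  set \<open>{0}\<close>.\<close>

lemma nn_integral_two_sided_exp_tail:
  fixes A :: "real set"
  assumes "0 \<le> \<xi>" "\<xi> \<le> 1" "\<theta> > 0" and A [measurable]: "A \<in> sets borel"
  shows "(\<integral>\<^sup>+y. ennreal (two_sided_exp_density \<xi> y) * (indicator A y * ennreal (tail \<theta> \<xi> n (\<theta> * y))) \<partial>lborel)
    = (\<integral>\<^sup>+y. ennreal (\<xi> * exp y * tail_neg \<theta> \<xi> n (\<theta> * y)) * indicator (A \<inter> {..0}) y \<partial>lborel)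
      + (\<integral>\<^sup>+y. ennreal ((1 - \<xi>) * exp (- y) * tail_pos \<theta> \<xi> n (\<theta> * y)) * indicator (A \<inter> {0..}) y \<partial>lborel)"
proof -
  have "(\<integral>\<^sup>+y. ennreal (two_sided_exp_density \<xi> y) * (indicator A y * ennreal (tail \<theta> \<xi> n (\<theta> * y))) \<partial>lborel)
    = (\<integral>\<^sup>+y. ennreal (\<xi> * exp y * tail_neg \<theta> \<xi> n (\<theta> * y)) * indicator (A \<inter> {..0}) y
      + ennreal ((1 - \<xi>) * exp (- y) * tail_pos \<theta> \<xi> n (\<theta> * y)) * indicator (A \<inter> {0..}) y \<partial>lborel)"
  proof (rule nn_integral_cong_AE)
    show "AE y in lborel. ennreal (two_sided_exp_density \<xi> y) * (indicator A y * ennreal (tail \<theta> \<xi> n (\<theta> * y)))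
      = ennreal (\<xi> * exp y * tail_neg \<theta> \<xi> n (\<theta> * y)) * indicator (A \<inter> {..0}) y
      + ennreal ((1 - \<xi>) * exp (- y) * tail_pos \<theta> \<xi> n (\<theta> * y)) * indicator (A \<inter> {0..}) y"
      using AE_lborel_singleton[of "0 :: real"]
    proof eventually_elim
      case (elim y)
      then consider "y < 0" | "y > 0" by linarith
      then show ?case
      proof cases
        case 1
        then have "\<theta> * y < 0" using assms(3) by (simp add: mult_less_0_iff)
        with 1 show ?thesis
          using assms(1) by (auto simp: two_sided_exp_density_def tail_def indicator_def ennreal_mult')
      next
        case 2
        then have "\<theta> * y > 0" using assms(3) by simp
        with 2 show ?thesis
          using assms(2) by (auto simp: two_sided_exp_density_def tail_def indicator_def ennreal_mult')
      qed
    qed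
  qed
  also have "\<dots> = (\<integral>\<^sup>+y. ennreal (\<xi> * exp y * tail_neg \<theta> \<xi> n (\<theta> * y)) * indicator (A \<inter> {..0}) y \<partial>lborel)
      + (\<integral>\<^sup>+y. ennreal ((1 - \<xi>) * exp (- y) * tail_pos \<theta> \<xi> n (\<theta> * y)) * indicator (A \<inter> {0..}) y \<partial>lborel)"
    by (rule nn_integral_add) measurable
  finally show ?thesis .
qed

text \<open>This is the final integration, over \<open>X 0\<close>, which has no lower constraint.
  The boundary values at 0 from the two half lines cancel by \<open>tail_neg_at_0\<close>.\<close>

lemma nn_integral_two_sided_exp_tail_UNIV:
  assumes "\<theta> > 0" "0 \<le> \<xi>" "\<xi> \<le> 1"
  shows "(\<integral>\<^sup>+y. ennreal (two_sided_exp_density \<xi> y) * ennreal (tail \<theta> \<xi> n (\<theta> * y)) \<partial>lborel)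
    = ennreal (persist_coeff \<theta> \<xi> (Suc n))"
  using nn_integral_two_sided_exp_tail[OF assms(2,3,1), of UNIV n] nn_integral_tail_neg[OF assms, of n]
    nn_integral_tail_pos[OF assms(1,3), of n 0] tail_pos_nonneg[OF assms(1,3), of "Suc n" 0]
  by (simp add: tail_neg_at_0[OF assms(1)] flip: ennreal_plus)

lemma nn_integral_two_sided_exp_tail_greaterThan:
  assumes "\<theta> > 0" "0 \<le> \<xi>" "\<xi> \<le> 1"
  shows "(\<integral>\<^sup>+y. ennreal (two_sided_exp_density \<xi> y)
            * (indicator {u<..} y * ennreal (tail \<theta> \<xi> n (\<theta> * y))) \<partial>lborel)
    = ennreal (tail \<theta> \<xi> (Suc n) u)"
proof -
  have "(\<integral>\<^sup>+y. ennreal (two_sided_exp_density \<xi> y)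
            * (indicator {u<..} y * ennreal (tail \<theta> \<xi> n (\<theta> * y))) \<partial>lborel)
      = (\<integral>\<^sup>+y. ennreal (two_sided_exp_density \<xi> y)
            * (indicator {u..} y * ennreal (tail \<theta> \<xi> n (\<theta> * y))) \<partial>lborel)"
    by (intro nn_integral_cong_AE eventually_mono[OF AE_lborel_singleton[of u]])
       (auto simp: indicator_def)
  also have "\<dots> = ennreal (tail \<theta> \<xi> (Suc n) u)"
  \<comment> \<open>For u < 0 the integral is split at 0 and the boundary values there cancel again.
    For u \<ge> 0 the negative branch contributes at most a single point.\<close>
  proof (cases "u < 0")
    case True
    then have "{u..} \<inter> {..0} = {u..0}" "{u..} \<inter> {0..} = {0..}" by auto
    then show ?thesis
      using nn_integral_two_sided_exp_tail[OF assms(2,3,1), of "{u..}" n]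
        nn_integral_tail_neg_Icc[OF assms, of u n] nn_integral_tail_pos[OF assms(1,3), of n 0]
        tail_pos_nonneg[OF assms(1,3), of "Suc n" 0] tail_neg_ge[OF assms, of u n] True
      by (simp add: tail_def tail_neg_at_0[OF assms(1)] flip: ennreal_plus)
  next
    case False
    have "(\<integral>\<^sup>+y. ennreal (\<xi> * exp y * tail_neg \<theta> \<xi> n (\<theta> * y)) * indicator ({u..} \<inter> {..0}) y \<partial>lborel)
        = (\<integral>\<^sup>+(y::real). 0 \<partial>lborel)"
      using False by (intro nn_integral_cong_AE eventually_mono[OF AE_lborel_singleton[of 0]])
        (auto simp: indicator_def)
    moreover have "{u..} \<inter> {0..} = {u..}" using False by auto
    ultimately show ?thesis
      using nn_integral_two_sided_exp_tail[OF assms(2,3,1), of "{u..}" n]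
        nn_integral_tail_pos[OF assms(1,3), of n u] False
      by (simp add: tail_def)
  qed
  finally show ?thesis .
qed

section \<open>From the probability space to iterated integrals\<close>

lemma two_sided_exp_density_measurable [measurable]:
  "two_sided_exp_density \<xi> \<in> borel_measurable borel"
  unfolding two_sided_exp_density_def[abs_def] by measurable

lemma iid_two_sided_exp_measurable:
  assumes "iid_two_sided_exp \<xi> M X"
  shows "X i \<in> borel_measurable M"
  using assms distributed_measurable[of M lborel "X i"] by (auto simp: iid_two_sided_exp_def)

text \<open>\<open>X (Suc m)\<close> is independent of the earlier variables, so it can be
  integrated first with the past fixed. Its constraint involves the past only through
  \<open>X m\<close>, so the inner integral is a function of \<open>X m\<close> and the step can be
  repeated.\<close>

lemma nn_integral_persistence_step:
  fixes h :: "real \<Rightarrow> ennreal"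
  assumes iid: "iid_two_sided_exp \<xi> M X" and h [measurable]: "h \<in> borel_measurable borel"
  shows "(\<integral>\<^sup>+\<omega>. indicator {\<omega>. \<forall>k\<in>{1..Suc m}. X k \<omega> > \<theta> * X (k - 1) \<omega>} \<omega> * h (X (Suc m) \<omega>) \<partial>M)
    = (\<integral>\<^sup>+\<omega>. indicator {\<omega>. \<forall>k\<in>{1..m}. X k \<omega> > \<theta> * X (k - 1) \<omega>} \<omega>
        * (\<integral>\<^sup>+y. ennreal (two_sided_exp_density \<xi> y) * (indicator {\<theta> * X m \<omega><..} y * h y) \<partial>lborel) \<partial>M)"
proof -
  interpret prob_space M using iid by (simp add: iid_two_sided_exp_def)
  note [measurable] = iid_two_sided_exp_measurable[OF iid]
  \<comment> \<open>Past and newest variable are packaged as restricted families, one over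
    \<open>{..m}\<close> and one over \<open>{Suc m}\<close>: disjoint index sets give independence
    of such families.\<close>
  define P where "P = PiM {..m} (\<lambda>_. borel :: real measure)"
  define U where "U \<omega> = restrict (\<lambda>i. X i \<omega>) {..m}" for \<omega>
  define Q where "Q = PiM {Suc m} (\<lambda>_. borel :: real measure)"
  define V where "V \<omega> = restrict (\<lambda>i. X i \<omega>) {Suc m}" for \<omega>
  define B where "B = {w \<in> space P. \<forall>k\<in>{1..m}. w k > \<theta> * w (k - 1)}"
  define G where "G = (\<lambda>(w, v). indicator B w * (indicator {y. \<theta> * w m < y} (v (Suc m)) * h (v (Suc m))))"
  have U [measurable]: "U \<in> measurable M P"
    unfolding U_def[abs_def] P_def by measurable
  have V [measurable]: "V \<in> measurable M Q"
    unfolding V_def[abs_def] Q_def by measurable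
  have coord [measurable]: "(\<lambda>w. w k) \<in> borel_measurable P" if "k \<le> m" for k
    unfolding P_def using that by (intro measurable_component_singleton) simp
  have B [measurable]: "B \<in> sets P"
    unfolding B_def by measurable auto
  have coord' [measurable]: "(\<lambda>v. v (Suc m)) \<in> borel_measurable Q"
    unfolding Q_def by (intro measurable_component_singleton) simp
  have "indep_var P U Q V"
    unfolding P_def Q_def U_def[abs_def] V_def[abs_def] using iid
    by (intro indep_var_restrict[where I = UNIV]) (auto simp: iid_two_sided_exp_def)
  then have joint: "distr M P U \<Otimes>\<^sub>M distr M Q V = distr M (P \<Otimes>\<^sub>M Q) (\<lambda>\<omega>. (U \<omega>, V \<omega>))"
    by (simp add: indep_var_distribution_eq)
  interpret D: prob_space "distr M Q V"
    by (rule prob_space_distr) measurable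
  have G [measurable]: "G \<in> borel_measurable (P \<Otimes>\<^sub>M Q)"
  proof -
    have "(\<lambda>z. snd z (Suc m)) \<in> borel_measurable (P \<Otimes>\<^sub>M Q)"
      using measurable_compose[OF measurable_snd coord'] by simp
    moreover
    have "(\<lambda>z. fst z m) \<in> borel_measurable (P \<Otimes>\<^sub>M Q)"
      using measurable_compose[OF measurable_fst coord[of m]] by simp
    ultimately show ?thesis unfolding G_def case_prod_beta by measurable
  qed
  have UB: "indicator B (U \<omega>) = indicator {\<omega>. \<forall>k\<in>{1..m}. X k \<omega> > \<theta> * X (k - 1) \<omega>} \<omega>" for \<omega>
  proof -
    have "U \<omega> \<in> space P" by (simp add: U_def P_def space_PiM)
    moreover have "(\<forall>k\<in>{1..m}. U \<omega> k > \<theta> * U \<omega> (k - 1)) \<longleftrightarrow> (\<forall>k\<in>{1..m}. X k \<omega> > \<theta> * X (k - 1) \<omega>)"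
      by (intro ball_cong) (auto simp: U_def)
    ultimately show ?thesis by (simp add: B_def indicator_def)
  qed
  have Um: "U \<omega> m = X m \<omega>" for \<omega> by (simp add: U_def)
  have Vm: "V \<omega> (Suc m) = X (Suc m) \<omega>" for \<omega> by (simp add: V_def)
  have "(\<integral>\<^sup>+\<omega>. indicator {\<omega>. \<forall>k\<in>{1..Suc m}. X k \<omega> > \<theta> * X (k - 1) \<omega>} \<omega> * h (X (Suc m) \<omega>) \<partial>M)
      = (\<integral>\<^sup>+\<omega>. G (U \<omega>, V \<omega>) \<partial>M)"
    by (intro nn_integral_cong)
       (auto simp: G_def UB Um Vm atLeastAtMostSuc_conv split: split_indicator)
  also have "\<dots> = (\<integral>\<^sup>+z. G z \<partial>distr M (P \<Otimes>\<^sub>M Q) (\<lambda>\<omega>. (U \<omega>, V \<omega>)))"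
    by (subst nn_integral_distr) auto
  also have "\<dots> = (\<integral>\<^sup>+w. \<integral>\<^sup>+y. G (w, y) \<partial>distr M Q V \<partial>distr M P U)"
    unfolding joint[symmetric] by (subst D.nn_integral_fst) auto
  also have "\<dots> = (\<integral>\<^sup>+\<omega>. \<integral>\<^sup>+y. G (U \<omega>, y) \<partial>distr M Q V \<partial>M)"
    by (subst nn_integral_distr) auto
  also have "\<dots> = (\<integral>\<^sup>+\<omega>. indicator {\<omega>. \<forall>k\<in>{1..m}. X k \<omega> > \<theta> * X (k - 1) \<omega>} \<omega>
        * (\<integral>\<^sup>+y. ennreal (two_sided_exp_density \<xi> y) * (indicator {\<theta> * X m \<omega><..} y * h y) \<partial>lborel) \<partial>M)"
  proof (rule nn_integral_cong)
    fix \<omega> assume "\<omega> \<in> space M"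
    let ?g = "\<lambda>y. indicator {\<theta> * X m \<omega><..} y * h y"
    have [measurable]: "U \<omega> \<in> space P"
      using measurable_space[OF U \<open>\<omega> \<in> space M\<close>] .
    have "(\<integral>\<^sup>+y. G (U \<omega>, y) \<partial>distr M Q V) = (\<integral>\<^sup>+\<omega>'. G (U \<omega>, V \<omega>') \<partial>M)"
      by (subst nn_integral_distr) auto
    also have "\<dots> = (\<integral>\<^sup>+\<omega>'. indicator B (U \<omega>) * ?g (X (Suc m) \<omega>') \<partial>M)"
      by (simp add: G_def Um Vm greaterThan_def)
    also have "\<dots> = indicator B (U \<omega>) * (\<integral>\<^sup>+\<omega>'. ?g (X (Suc m) \<omega>') \<partial>M)"
      by (subst nn_integral_cmult) auto
    also have "(\<integral>\<^sup>+\<omega>'. ?g (X (Suc m) \<omega>') \<partial>M) = (\<integral>\<^sup>+y. ennreal (two_sided_exp_density \<xi> y) * ?g y \<partial>lborel)"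
      using iid by (intro distributed_nn_integral[symmetric]) (auto simp: iid_two_sided_exp_def)
    finally show "(\<integral>\<^sup>+y. G (U \<omega>, y) \<partial>distr M Q V)
        = indicator {\<omega>. \<forall>k\<in>{1..m}. X k \<omega> > \<theta> * X (k - 1) \<omega>} \<omega>
          * (\<integral>\<^sup>+y. ennreal (two_sided_exp_density \<xi> y) * ?g y \<partial>lborel)"
      by (simp add: UB)
  qed
  finally show ?thesis .
qed

lemma persistence_prob_eq_persist_coeff:
  assumes "\<theta> > 0" "0 \<le> \<xi>" "\<xi> \<le> 1" and iid: "iid_two_sided_exp \<xi> M X"
  shows "persistence_prob M X \<theta> n = persist_coeff \<theta> \<xi> (Suc n)"
proof -
  interpret prob_space M using iid by (simp add: iid_two_sided_exp_def)
  note [measurable] = iid_two_sided_exp_measurable[OF iid]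
  define A where "A m = {\<omega>. \<forall>k\<in>{1..m}. X k \<omega> > \<theta> * X (k - 1) \<omega>}" for m
  \<comment> \<open>The last k variables are integrated out and \<open>tail\<close> records their
    contribution. The index m must vary, because \<open>m + Suc k\<close> is regrouped as
    \<open>Suc m + k\<close> before \<open>X (Suc m)\<close> is removed. The case m = 0 is the goal,
    since \<open>A 0\<close> imposes no constraint.\<close>
  have step: "(\<integral>\<^sup>+\<omega>. indicator (A (m + k)) \<omega> \<partial>M)
      = (\<integral>\<^sup>+\<omega>. indicator (A m) \<omega> * ennreal (tail \<theta> \<xi> k (\<theta> * X m \<omega>)) \<partial>M)" for k m
  proof (induction k arbitrary: m)
    case (Suc k)
    have "(\<integral>\<^sup>+\<omega>. indicator (A (m + Suc k)) \<omega> \<partial>M)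
        = (\<integral>\<^sup>+\<omega>. indicator (A (Suc m)) \<omega> * ennreal (tail \<theta> \<xi> k (\<theta> * X (Suc m) \<omega>)) \<partial>M)"
      using Suc.IH[of "Suc m"] by simp
    also have "\<dots> = (\<integral>\<^sup>+\<omega>. indicator (A m) \<omega> * ennreal (tail \<theta> \<xi> (Suc k) (\<theta> * X m \<omega>)) \<partial>M)"
      unfolding A_def
      by (subst nn_integral_persistence_step[OF iid, where h = "\<lambda>y. ennreal (tail \<theta> \<xi> k (\<theta> * y))"])
         (simp_all add: nn_integral_two_sided_exp_tail_greaterThan[OF assms(1-3)])
    finally show ?case .
  qed simp
  have "emeasure M {\<omega> \<in> space M. \<forall>k\<in>{1..n}. X k \<omega> > \<theta> * X (k - 1) \<omega>}
      = (\<integral>\<^sup>+\<omega>. indicator {\<omega> \<in> space M. \<forall>k\<in>{1..n}. X k \<omega> > \<theta> * X (k - 1) \<omega>} \<omega> \<partial>M)"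
    by (subst nn_integral_indicator) measurable
  also have "\<dots> = (\<integral>\<^sup>+\<omega>. indicator (A (0 + n)) \<omega> \<partial>M)"
    by (intro nn_integral_cong) (auto simp: A_def indicator_def)
  also have "\<dots> = (\<integral>\<^sup>+\<omega>. ennreal (tail \<theta> \<xi> n (\<theta> * X 0 \<omega>)) \<partial>M)"
    unfolding step by (simp add: A_def)
  also have "\<dots> = (\<integral>\<^sup>+y. ennreal (two_sided_exp_density \<xi> y) * ennreal (tail \<theta> \<xi> n (\<theta> * y)) \<partial>lborel)"
    using iid by (intro distributed_nn_integral[symmetric]) (auto simp: iid_two_sided_exp_def)
  also have "\<dots> = ennreal (persist_coeff \<theta> \<xi> (Suc n))"
    by (rule nn_integral_two_sided_exp_tail_UNIV[OF assms(1-3)])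
  finally show ?thesis
    unfolding persistence_prob_def
    using persist_coeff_nonneg[OF assms(1-3)] by (simp add: measure_def)
qed

section \<open>Closed forms and the final assembly\<close>

lemma prod_power_eq: "(\<Prod>k<Suc n. \<theta> ^ k) = (\<theta> :: real) ^ (n * (n + 1) div 2)"
  by (simp add: power_sum[symmetric] Sum_Ico_nat gauss_sum_nat lessThan_Suc_atMost atLeast0AtMost[symmetric]
      del: prod.lessThan_Suc)

text \<open>Taking 1 - \<xi> out of each numerator factor leaves a factor of the first Pochhammer
  symbol. The second one is the q-factorial with its denominators 1 - \<theta> cleared.\<close>

lemma persist_coeff_pochhammer:
  assumes "\<theta> > 0" "\<theta> \<noteq> 1" "\<xi> < 1"
  shows "persist_coeff \<theta> \<xi> m
    = q_pochhammer (- (\<xi> / (1 - \<xi>))) \<theta> m / q_pochhammer \<theta> \<theta> m * (1 - \<theta>) ^ m * (1 - \<xi>) ^ m"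
proof -
  have "q_fact \<theta> m = q_pochhammer \<theta> \<theta> m / (1 - \<theta>) ^ m"
    using assms(2) by (simp add: q_fact_def q_pochhammer_def prod_dividef prod.atLeast1_atMost_eq)
  moreover have "(\<Prod>k<m. 1 - \<xi> + \<xi> * \<theta> ^ k) = q_pochhammer (- (\<xi> / (1 - \<xi>))) \<theta> m * (1 - \<xi>) ^ m"
  proof -
    have "q_pochhammer (- (\<xi> / (1 - \<xi>))) \<theta> m * (1 - \<xi>) ^ m
        = (\<Prod>k<m. (1 - - (\<xi> / (1 - \<xi>)) * \<theta> ^ k) * (1 - \<xi>))"
      unfolding q_pochhammer_def by (simp add: prod.distrib)
    also have "\<dots> = (\<Prod>k<m. 1 - \<xi> + \<xi> * \<theta> ^ k)"
      using assms(3) by (intro prod.cong) (auto simp: field_simps)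
    finally show ?thesis ..
  qed
  ultimately show ?thesis by (simp add: persist_coeff_def)
qed

theorem theorem1:
  fixes \<theta> \<xi> :: real
    and M :: "'a measure" and X :: "nat \<Rightarrow> 'a \<Rightarrow> real"
  assumes "\<theta> > 0" and "0 \<le> \<xi>" and "\<xi> \<le> 1"
    and "iid_two_sided_exp \<xi> M X"
  shows
    "(\<forall>(N :: 'b measure) Y. iid_two_sided_exp (1 - \<xi>) N Y \<longrightarrow>
        (\<forall>n\<ge>1. persistence_prob M X \<theta> n = persistence_prob N Y (1 / \<theta>) n))
     \<and> (\<theta> = 1 \<longrightarrow> (\<forall>n\<ge>1. persistence_prob M X \<theta> n = 1 / fact (n + 1)))
     \<and> (\<xi> = 1 \<longrightarrow>
          (\<forall>n\<ge>1. persistence_prob M X \<theta> n = \<theta> ^ (n * (n + 1) div 2) / q_fact \<theta> (n + 1)))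
     \<and> (\<xi> = 0 \<longrightarrow> (\<forall>n\<ge>1. persistence_prob M X \<theta> n = 1 / q_fact \<theta> (n + 1)))
     \<and> (\<theta> \<noteq> 1 \<and> \<xi> < 1 \<longrightarrow>
          (\<forall>n\<ge>1. persistence_prob M X \<theta> n =
             q_pochhammer (- (\<xi> / (1 - \<xi>))) \<theta> (n + 1) / q_pochhammer \<theta> \<theta> (n + 1)
               * (1 - \<theta>) ^ (n + 1) * (1 - \<xi>) ^ (n + 1)))
     \<and> (\<forall>z::complex. norm z < 1 \<longrightarrow> q_exp \<theta> (- of_real \<xi> * z) \<noteq> 0)
     \<and> (\<forall>z::complex. norm z < 1 \<and> z \<noteq> 0 \<longrightarrow>
          (\<lambda>n. of_real (persistence_prob M X \<theta> (Suc n)) * z ^ Suc n) sums persistence_gf \<theta> \<xi> z)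
     \<and> (persistence_gf \<theta> \<xi> \<longlongrightarrow>
          (\<Sum>n. of_real (persistence_prob M X \<theta> (Suc n)) * 0 ^ Suc n)) (at 0)"
proof (intro conjI allI impI)
  note p = persistence_prob_eq_persist_coeff[OF assms]
  show "persistence_prob M X \<theta> n = persistence_prob N Y (1 / \<theta>) n"
    if "iid_two_sided_exp (1 - \<xi>) N Y" for N :: "'b measure" and Y n
    using persistence_prob_eq_persist_coeff[OF _ _ _ that, of "1 / \<theta>" n] assms
    by (simp add: p persist_coeff_inverse)
  show "persistence_prob M X \<theta> n = 1 / fact (n + 1)" if "\<theta> = 1" for n
    unfolding p persist_coeff_def using that by (simp add: q_fact_def)
  show "persistence_prob M X \<theta> n = \<theta> ^ (n * (n + 1) div 2) / q_fact \<theta> (n + 1)" if "\<xi> = 1" for n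
    unfolding p persist_coeff_def prod_power_eq[symmetric] using that by simp
  show "persistence_prob M X \<theta> n = 1 / q_fact \<theta> (n + 1)" if "\<xi> = 0" for n
    using that by (simp add: p persist_coeff_def)
  show "persistence_prob M X \<theta> n =
      q_pochhammer (- (\<xi> / (1 - \<xi>))) \<theta> (n + 1) / q_pochhammer \<theta> \<theta> (n + 1)
        * (1 - \<theta>) ^ (n + 1) * (1 - \<xi>) ^ (n + 1)" if "\<theta> \<noteq> 1 \<and> \<xi> < 1" for n
    unfolding p Suc_eq_plus1 using that assms(1) by (intro persist_coeff_pochhammer) auto
  show "q_exp \<theta> (- of_real \<xi> * z) \<noteq> 0" if "norm z < 1" for z
    using le_less_trans[OF mult_left_le_one_le[of "norm z" \<xi>] that] assms
    by (intro q_exp_nonzero) (simp_all add: norm_mult)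
  show sums: "(\<lambda>n. of_real (persistence_prob M X \<theta> (Suc n)) * z ^ Suc n) sums persistence_gf \<theta> \<xi> z"
    if "norm z < 1 \<and> z \<noteq> 0" for z
    using persist_coeff_gf_sums[OF assms(1-3), of z] that by (simp add: p)
  \<comment> \<open>Prepending a zero constant term gives a genuine power series, which is
    continuous at 0. A limit is needed because \<open>persistence_gf \<theta> \<xi> 0\<close>
    evaluates to -1 under the convention 1 / 0 = 0, whereas the series has value 0 there.\<close>
  define a where "a n = (case n of 0 \<Rightarrow> 0 | Suc m \<Rightarrow> complex_of_real (persistence_prob M X \<theta> (Suc m)))" for n
  have "(persistence_gf \<theta> \<xi> \<longlongrightarrow> a 0) (at 0)"
  proof (rule powser_limit_0_strong[of 1])
    fix z :: complex assume "z \<noteq> 0" "norm z < 1"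
    then have "(\<lambda>n. a (Suc n) * z ^ Suc n) sums persistence_gf \<theta> \<xi> z"
      using sums by (simp add: a_def)
    then show "(\<lambda>n. a n * z ^ n) sums persistence_gf \<theta> \<xi> z"
      using sums_Suc_iff[of "\<lambda>n. a n * z ^ n" "persistence_gf \<theta> \<xi> z"] by (simp add: a_def)
  qed simp
  then show "(persistence_gf \<theta> \<xi> \<longlongrightarrow>
      (\<Sum>n. of_real (persistence_prob M X \<theta> (Suc n)) * 0 ^ Suc n)) (at 0)"
    by (simp add: a_def)
qed

end
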